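(* Let $n\ge 2$ and $1\le a\le 2n-2$ be integers, and let $\mathcal{Z}=T_a=\{(x,y)\in\mathbb{Z}_+^2\colon x+y\le a-1\}$. If $a$ is even, then $$\gamma(\mathcal{Z},n,n)=\frac{an}{2}.$$ If $a$ is odd and $a\le n$, then $$\gamma(\mathcal{Z},n,n)=\frac{a+1}{2}\,n-\frac{a-1}{2}.$$ If $a$ is odd and $a>n$, then $$\gamma(\mathcal{Z},n,n)=\frac{a-1}{2}\,n+\left\lceil\frac{n(2n-a+1)}{2(2n-a)}\right\rceil.$$
   Context: $\mathbb{Z}_+=\{0,1,2,\dots\}$, $\mathbb{N}=\{1,2,\dots\}$, $[0,c]=\{0,1,\dots,c\}$, and $R_{a,b}=[0,a-1]\times[0,b-1]$. A zero-set (Young diagram) is a downward-closed set $\mathcal{Z}\subseteq\mathbb{Z}_+^2$. For $m,n\in\mathbb{N}$, the graph $K_m\Box K_n$ is represented on the vertex set $R_{n,m}=[0,n-1]\times[0,m-1]$, with two vertices adjacent iff they differ in exactly one coordinate. For $v=(j,i)\in R_{n,m}$, the row neighborhood $\mathcal{N}^r(v)$ is the set of all $(j',i)\in R_{n,m}$ with $j'\neq j$, and the column neighborhood $\mathcal{N}^c(v)$ is the set of all $(j,i')\in R_{n,m}$ with $i'\ne i$. Given $\mathcal{Z}$, for $A\subseteq R_{n,m}$ let $\mathcal{T}(A)=A\cup\{v\in R_{n,m}\setminus A\colon (|\mathcal{N}^r(v)\cap A|,|\mathcal{N}^c(v)\cap A|)\notin\mathcal{Z}\}$. Then $\gamma(\mathcal{Z},m,n)=\min\{|A|\colon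 A\subseteq R_{n,m},\ \mathcal{T}(A)=R_{n,m}\}$. (Thus $\gamma(T_a,n,n)$ is the $a$-domination number of $K_n\Box K_n$: the minimum size of a vertex set $D$ such that each vertex outside $D$ has at least $a$ neighbors in $D$.) *)

theory Defs
  imports Complex_Main
begin

definition zero_set :: "(nat \<times> nat) set \<Rightarrow> bool" where
  "zero_set Z \<longleftrightarrow>
     (\<forall>x y x' y'. (x, y) \<in> Z \<longrightarrow> x' \<le> x \<longrightarrow> y' \<le> y \<longrightarrow> (x', y') \<in> Z)"

definition rect :: "nat \<Rightarrow> nat \<Rightarrow> (nat \<times> nat) set" where
  "rect a b = {0..<a} \<times> {0..<b}"

text \<open>
  In the following definitions the graph is the Cartesian product of the complete graphs on m and
  on n vertices. Its vertex set is \<^term>\<open>rect n m\<close>: the first coordinate has n values, the second m.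
\<close>

definition row_nbhd :: "nat \<Rightarrow> nat \<Rightarrow> nat \<times> nat \<Rightarrow> (nat \<times> nat) set" where
  "row_nbhd m n v = {w \<in> rect n m. snd w = snd v \<and> fst w \<noteq> fst v}"

definition col_nbhd :: "nat \<Rightarrow> nat \<Rightarrow> nat \<times> nat \<Rightarrow> (nat \<times> nat) set" where
  "col_nbhd m n v = {w \<in> rect n m. fst w = fst v \<and> snd w \<noteq> snd v}"

definition growth :: "(nat \<times> nat) set \<Rightarrow> nat \<Rightarrow> nat \<Rightarrow> (nat \<times> nat) set \<Rightarrow> (nat \<times> nat) set" where
  "growth Z m n A =
     A \<union> {v \<in> rect n m - A. (card (row_nbhd m n v \<inter> A), card (col_nbhd m n v \<inter> A)) \<notin> Z}"

text \<open>
  The minimum is over a finite set, which is nonempty since \<^term>\<open>A = rect n m\<close> is admissible.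
\<close>

definition gamma_num :: "(nat \<times> nat) set \<Rightarrow> nat \<Rightarrow> nat \<Rightarrow> nat" where
  "gamma_num Z m n = Min (card ` {A. A \<subseteq> rect n m \<and> growth Z m n A = rect n m})"

text \<open>
  Strict inequality instead of \<open>x + y \<le> a - 1\<close> avoids truncated subtraction at a = 0.
\<close>

definition triangle :: "nat \<Rightarrow> (nat \<times> nat) set" where
  "triangle a = {(x, y). x + y < a}"

lemma zero_set_triangle: "zero_set (triangle a)"
  by (auto simp: zero_set_def triangle_def)

end

theory Submission
  imports Defs
begin

text \<open>
  Lower bounds: summing the condition "row degree plus column degree is at least \<open>a\<close>" over all
  vertices outside of \<open>A\<close> bounds the sum of the squared degrees from above. Bounding it from below by
  \<open>(d - k)\<^sup>2 \<ge> 0\<close> if \<open>a = 2 * k\<close>, and by \<open>(d - k) * (d - k - 1) \<ge> 0\<close> for integers \<open>d\<close> if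
  \<open>a = 2 * k + 1\<close>, gives the even case and the case \<open>a > n\<close>. For odd \<open>a \<le> n\<close>, take a line of minimal
  degree and count \<open>A\<close> along the lines crossing it.

  Upper bounds: if the first \<open>u\<close> rows and columns have degree \<open>k\<close>, meet in a full block, and all
  other lines have degree \<open>k + 1\<close>, then the set dominates for \<open>a = 2 * k + 1\<close>. The extremal
  choices are \<open>u = k\<close> if \<open>a \<le> n\<close>, and \<open>n - u\<close> the rounded-up quotient if \<open>a > n\<close>. For even \<open>a\<close>
  take \<open>u = 0\<close>.
\<close>

section \<open>Domination in terms of line degrees\<close>

text \<open>With relational images, \<open>deg (A\<inverse>)\<close> gives the degrees of the lines
  in the other direction, so an argument for one direction passes to the other by taking the
  converse.\<close>

definition deg :: "(nat \<times> nat) set \<Rightarrow> nat \<Rightarrow> nat" where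
  "deg A x = card (A `` {x})"

definition dominating :: "nat \<Rightarrow> nat \<Rightarrow> (nat \<times> nat) set \<Rightarrow> bool" where
  "dominating a n A \<longleftrightarrow> A \<subseteq> {..<n} \<times> {..<n} \<and>
     (\<forall>x<n. \<forall>y<n. (x, y) \<notin> A \<longrightarrow> a \<le> deg A x + deg (A\<inverse>) y)"

lemma dominating_converse: "dominating a n A \<Longrightarrow> dominating a n (A\<inverse>)"
  unfolding dominating_def by (auto simp: add.commute)

text \<open>For a vertex outside \<open>A\<close>, leaving it out of its own lines does not change
  their intersections with \<open>A\<close>. Both neighborhood counts are therefore full line
  degrees.\<close>

lemma growth_triangle_eq_rect_iff:
  assumes "A \<subseteq> rect n n"
  shows "growth (triangle a) n n A = rect n n \<longleftrightarrow> dominating a n A"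
proof -
  have row: "card (row_nbhd n n (x, y) \<inter> A) = deg (A\<inverse>) y" if "(x, y) \<notin> A" for x y
  proof -
    have "row_nbhd n n (x, y) \<inter> A = (\<lambda>x'. (x', y)) ` (A\<inverse> `` {y})"
      using that assms by (auto simp: row_nbhd_def)
    then show ?thesis
      by (simp add: deg_def card_image inj_on_def)
  qed
  have col: "card (col_nbhd n n (x, y) \<inter> A) = deg A x" if "(x, y) \<notin> A" for x y
  proof -
    have "col_nbhd n n (x, y) \<inter> A = Pair x ` (A `` {x})"
      using that assms by (auto simp: col_nbhd_def)
    then show ?thesis
      by (simp add: deg_def card_image inj_on_def)
  qed
  have "growth (triangle a) n n A =
      A \<union> {(x, y). (x, y) \<in> rect n n - A \<and> a \<le> deg A x + deg (A\<inverse>) y}"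
    unfolding growth_def triangle_def by (auto simp: row col not_less add.commute)
  moreover have "rect n n = {..<n} \<times> {..<n}"
    by (auto simp: rect_def)
  ultimately show ?thesis
    using assms unfolding dominating_def by auto
qed

lemma gamma_num_triangle_eqI:
  assumes "dominating a n A" and "card A = m"
    and "\<And>B. dominating a n B \<Longrightarrow> m \<le> card B"
  shows "gamma_num (triangle a) n n = m"
proof -
  have rect: "rect n n = {..<n} \<times> {..<n}"
    by (auto simp: rect_def)
  have eq: "{A. A \<subseteq> rect n n \<and> growth (triangle a) n n A = rect n n} = {A. dominating a n A}"
    using growth_triangle_eq_rect_iff[of _ n a] by (auto simp: dominating_def rect)
  have "finite {A. dominating a n A}"
    by (rule finite_subset[of _ "Pow ({..<n} \<times> {..<n})"]) (auto simp: dominating_def)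
  then show ?thesis
    unfolding gamma_num_def eq using assms by (intro Min_eqI) auto
qed

section \<open>Lower bounds\<close>

text \<open>Each first coordinate \<open>x\<close> occurs \<open>deg A x\<close> times in
  \<open>A\<close>. Constant \<open>g\<close> yields the size of \<open>A\<close>; taking the degree
  for \<open>g\<close> yields the sum of squared degrees.\<close>

lemma sum_fst_eq_sum_deg:
  fixes g :: "nat \<Rightarrow> int"
  assumes "A \<subseteq> {..<n} \<times> {..<n}"
  shows "(\<Sum>p\<in>A. g (fst p)) = (\<Sum>x<n. int (deg A x) * g x)"
proof -
  have A: "A = Sigma {..<n} (\<lambda>x. A `` {x})"
    using assms by auto
  have "finite (A `` {x})" for x
    by (rule finite_subset[of _ "{..<n}"]) (use assms in auto)
  then have "(\<Sum>x<n. \<Sum>y\<in>A `` {x}. g x) = (\<Sum>(x, y)\<in>Sigma {..<n} (\<lambda>x. A `` {x}). g x)"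
    by (intro sum.Sigma) auto
  then show ?thesis
    by (subst A) (simp add: deg_def split_def)
qed

lemma sum_snd_eq_sum_deg:
  fixes g :: "nat \<Rightarrow> int"
  assumes "A \<subseteq> {..<n} \<times> {..<n}"
  shows "(\<Sum>p\<in>A. g (snd p)) = (\<Sum>y<n. int (deg (A\<inverse>) y) * g y)"
proof -
  have "(\<Sum>p\<in>A. g (snd p)) = (\<Sum>p\<in>A\<inverse>. g (fst p))"
    by (rule sum.reindex_bij_witness[where i = prod.swap and j = prod.swap]) auto
  also have "\<dots> = (\<Sum>y<n. int (deg (A\<inverse>) y) * g y)"
    using assms by (intro sum_fst_eq_sum_deg) auto
  finally show ?thesis .
qed

lemma card_eq_sum_deg:
  assumes "A \<subseteq> {..<n} \<times> {..<n}"
  shows "(\<Sum>x<n. int (deg A x)) = int (card A)" "(\<Sum>x<n. int (deg (A\<inverse>) x)) = int (card A)"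
  using sum_fst_eq_sum_deg[OF assms, of "\<lambda>_. 1"] sum_snd_eq_sum_deg[OF assms, of "\<lambda>_. 1"]
  by simp_all

lemma dominating_sum_squares:
  assumes "dominating a n A"
  shows "(\<Sum>x<n. (int (deg A x))\<^sup>2) + (\<Sum>y<n. (int (deg (A\<inverse>) y))\<^sup>2)
    \<le> (2 * int n + int a) * int (card A) - int a * (int n)\<^sup>2"
proof -
  let ?S = "{..<n} \<times> {..<n}"
  define f where "f p = int (deg A (fst p)) + int (deg (A\<inverse>) (snd p))" for p
  have A: "A \<subseteq> ?S"
    using assms by (simp add: dominating_def)
  have fin: "finite A"
    using A finite_subset by blast
  have "int a * (int n)\<^sup>2 - int a * int (card A) = (\<Sum>p\<in>?S - A. int a)"
    using A fin by (simp add: card_Diff_subset of_nat_diff card_mono[OF _ A, simplified]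
        power2_eq_square algebra_simps)
  also have "\<dots> \<le> (\<Sum>p\<in>?S - A. f p)"
    using assms unfolding dominating_def f_def by (intro sum_mono) (auto simp flip: of_nat_add)
  \<comment> \<open>Over the whole square every line degree is counted \<open>n\<close> times,
    whereas over \<open>A\<close> a line of degree \<open>d\<close> contributes \<open>d\<close>
    copies of \<open>d\<close>; this is the source of the squares.\<close>
  also have "\<dots> = (\<Sum>p\<in>?S. f p) - (\<Sum>p\<in>A. f p)"
    using A by (intro sum_diff) auto
  also have "(\<Sum>p\<in>?S. f p) = (\<Sum>x<n. \<Sum>y<n. f (x, y))"
    by (simp add: sum.cartesian_product)
  also have "\<dots> = 2 * int n * int (card A)"
    by (simp add: f_def sum.distrib card_eq_sum_deg[OF A] flip: sum_distrib_left)
  also have "(\<Sum>p\<in>A. f p) = (\<Sum>x<n. (int (deg A x))\<^sup>2) + (\<Sum>y<n. (int (deg (A\<inverse>) y))\<^sup>2)"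
    using sum_fst_eq_sum_deg[OF A, of "\<lambda>x. int (deg A x)"]
      sum_snd_eq_sum_deg[OF A, of "\<lambda>y. int (deg (A\<inverse>) y)"]
    by (simp add: f_def sum.distrib power2_eq_square)
  finally show ?thesis
    by (simp add: algebra_simps)
qed

text \<open>An affine function below the parabola at all integers replaces the squares by terms
  linear in the degrees, and the degrees sum to \<open>card A\<close> in either direction.\<close>

lemma dominating_quadratic_bound:
  fixes p q :: int
  assumes dom: "dominating a n A"
    and bound: "\<And>d :: int. p * d - q \<le> d\<^sup>2"
  shows "int a * (int n)\<^sup>2 \<le> (2 * int n + int a - 2 * p) * int (card A) + 2 * int n * q"
proof -
  have A: "A \<subseteq> {..<n} \<times> {..<n}"
    using dom by (simp add: dominating_def)
  have "(\<Sum>x<n. p * int (deg A x) - q) + (\<Sum>x<n. p * int (deg (A\<inverse>) x) - q)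
      \<le> (\<Sum>x<n. (int (deg A x))\<^sup>2) + (\<Sum>x<n. (int (deg (A\<inverse>) x))\<^sup>2)"
    by (intro add_mono sum_mono bound)
  moreover have "(\<Sum>x<n. p * int (deg A x) - q) + (\<Sum>x<n. p * int (deg (A\<inverse>) x) - q)
      = 2 * (p * int (card A) - int n * q)"
    by (simp add: sum_subtractf card_eq_sum_deg[OF A] flip: sum_distrib_left)
  ultimately show ?thesis
    using dominating_sum_squares[OF dom] by (simp add: algebra_simps)
qed

lemma dominating_even_card_ge:
  assumes "dominating (2 * k) n A" and "k < n"
  shows "k * n \<le> card A"
proof -
  let ?k = "int k" and ?n = "int n"
  \<comment> \<open>This is the tangent to the parabola at \<open>d = k\<close>. It leaves the
    common factor \<open>2 * (n - k)\<close>, which is positive.\<close>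
  have "2 * ?k * d - ?k\<^sup>2 \<le> d\<^sup>2" for d
    using zero_le_power2[of "d - ?k"] by (simp add: power2_diff algebra_simps)
  from dominating_quadratic_bound[OF assms(1) this]
  have "2 * (?n - ?k) * (?k * ?n) \<le> 2 * (?n - ?k) * int (card A)"
    by (simp add: algebra_simps power2_eq_square)
  then have "?k * ?n \<le> int (card A)"
    using assms(2) by (subst (asm) mult_le_cancel_left) auto
  then show ?thesis
    by (simp flip: of_nat_mult)
qed

lemma dominating_odd_card_ge:
  assumes "dominating (2 * k + 1) n A"
  shows "int n * (int n - int k) \<le> (2 * int n - 2 * int k - 1) * (int (card A) - int k * int n)"
proof -
  let ?k = "int k" and ?n = "int n"
  \<comment> \<open>This is the secant through \<open>d = k\<close> and \<open>d = k + 1\<close>,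
    which exceeds the parabola only strictly between these consecutive integers.\<close>
  have bound: "(2 * ?k + 1) * d - ?k * (?k + 1) \<le> d\<^sup>2" for d
  proof -
    have "0 \<le> (d - ?k) * (d - ?k - 1)"
      by (cases "d \<le> ?k") (auto intro: mult_nonneg_nonneg mult_nonpos_nonpos)
    then show ?thesis
      by (simp add: power2_eq_square algebra_simps)
  qed
  from dominating_quadratic_bound[OF assms bound] show ?thesis
    by (simp add: algebra_simps power2_eq_square)
qed

text \<open>Count \<open>A\<close> along the lines crossing \<open>x\<close>: the
  \<open>n - d\<close> lines that meet it outside of \<open>A\<close> have degree at least
  \<open>a - d\<close> by domination, and the other \<open>d\<close> have degree at least
  \<open>d\<close> by minimality.\<close>

lemma dominating_card_ge_min_deg:
  assumes dom: "dominating a n A" and x: "x < n" and d: "d = deg A x"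
    and min: "\<And>y. y < n \<Longrightarrow> d \<le> deg (A\<inverse>) y"
  shows "(int n - int d) * (int a - int d) + (int d)\<^sup>2 \<le> int (card A)"
proof -
  have A: "A \<subseteq> {..<n} \<times> {..<n}"
    using dom by (simp add: dominating_def)
  have N: "A `` {x} \<subseteq> {..<n}"
    using A by auto
  then have fin: "finite (A `` {x})"
    using finite_subset by blast
  have "(\<Sum>y\<in>{..<n} - A `` {x}. int a - int d) \<le> (\<Sum>y\<in>{..<n} - A `` {x}. int (deg (A\<inverse>) y))"
    using dom x unfolding dominating_def d by (intro sum_mono) force
  moreover have "(\<Sum>y\<in>A `` {x}. int d) \<le> (\<Sum>y\<in>A `` {x}. int (deg (A\<inverse>) y))"
    using N min by (intro sum_mono) auto
  moreover have "(\<Sum>y\<in>{..<n} - A `` {x}. int (deg (A\<inverse>) y)) + (\<Sum>y\<in>A `` {x}. int (deg (A\<inverse>) y))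
      = int (card A)"
    using sum.subset_diff[OF N, of "\<lambda>y. int (deg (A\<inverse>) y)"] card_eq_sum_deg(2)[OF A] by simp
  moreover have "int (card ({..<n} - A `` {x})) = int n - int d"
    using card_mono[OF _ N] fin N by (simp add: card_Diff_subset of_nat_diff d deg_def)
  moreover have "card (A `` {x}) = d"
    by (simp add: d deg_def)
  ultimately show ?thesis
    by (simp add: power2_eq_square)
qed

lemma dominating_odd_small_card_ge:
  assumes dom: "dominating (2 * k + 1) n A" and k: "2 * k + 1 \<le> n"
  shows "k * n + (n - k) \<le> card A"
proof -
  let ?k = "int k" and ?n = "int n"
  \<comment> \<open>Stated for any \<open>B\<close>, to be applied to \<open>A\<close> or to
    \<open>A\<inverse>\<close>, depending on which direction contains a line of least
    degree.\<close>
  have main: "?k * ?n + (?n - ?k) \<le> int (card B)"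
    if B: "dominating (2 * k + 1) n B" and x: "x < n"
      and row: "\<And>x'. x' < n \<Longrightarrow> deg B x \<le> deg B x'"
      and col: "\<And>y. y < n \<Longrightarrow> deg B x \<le> deg (B\<inverse>) y" for B x
  proof (cases "deg B x \<le> k")
    case True
    define d where "d = int (deg B x)"
    \<comment> \<open>The product is exactly the difference between the bound for minimal degree
      \<open>d\<close> and its value at \<open>d = k\<close>, which is the claimed one.\<close>
    have "0 \<le> (?k - d) * (?n + 2 * ?k + 1 - 2 * (d + ?k))"
      using True k by (intro mult_nonneg_nonneg) (auto simp: d_def)
    moreover have "(?n - d) * (2 * ?k + 1 - d) + d\<^sup>2 \<le> int (card B)"
      using dominating_card_ge_min_deg[OF B x refl col] by (simp add: d_def add.commute)
    ultimately show ?thesis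
      by (simp add: algebra_simps power2_eq_square)
  next
    case False
    have "(\<Sum>x'<n. ?k + 1) \<le> (\<Sum>x'<n. int (deg B x'))"
    proof (rule sum_mono)
      fix x' assume "x' \<in> {..<n}"
      then show "?k + 1 \<le> int (deg B x')"
        using False row[of x'] by auto
    qed
    then have "?n * (?k + 1) \<le> int (card B)"
      using B by (simp add: card_eq_sum_deg dominating_def)
    then show ?thesis
      by (simp add: algebra_simps)
  qed
  have "n > 0"
    using k by simp
  then have ne: "{..<n} \<noteq> {}"
    by auto
  define x where "x = arg_min_on (deg A) {..<n}"
  define y where "y = arg_min_on (deg (A\<inverse>)) {..<n}"
  have x: "x < n" "\<And>x'. x' < n \<Longrightarrow> deg A x \<le> deg A x'"
    using arg_min_if_finite[OF finite_lessThan ne, of "deg A"] by (auto simp: x_def not_less)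
  have y: "y < n" "\<And>y'. y' < n \<Longrightarrow> deg (A\<inverse>) y \<le> deg (A\<inverse>) y'"
    using arg_min_if_finite[OF finite_lessThan ne, of "deg (A\<inverse>)"] by (auto simp: y_def not_less)
  have "?k * ?n + (?n - ?k) \<le> int (card A)"
  proof (cases "deg A x \<le> deg (A\<inverse>) y")
    case True
    then show ?thesis
      using main[OF dom x] y(2) by (meson le_trans)
  next
    case False
    then have "?k * ?n + (?n - ?k) \<le> int (card (A\<inverse>))"
      using main[OF dominating_converse[OF dom] y] x(2) by simp (meson le_trans nat_le_linear)
    then show ?thesis
      by simp
  qed
  also have "?k * ?n + (?n - ?k) = int (k * n + (n - k))"
    using k by (simp add: of_nat_diff)
  finally show ?thesis
    by linarith
qed

section \<open>Cyclic filling\<close>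

text \<open>
  The cells of row \<open>i\<close> are \<open>z i\<close> cyclically consecutive columns modulo \<open>q\<close>, starting where row
  \<open>i - 1\<close> stopped. Hence the columns are filled as evenly as possible, whatever the row sizes are.
\<close>

definition cyclic_fill :: "(nat \<Rightarrow> nat) \<Rightarrow> nat \<Rightarrow> (nat \<times> nat) set" where
  "cyclic_fill z q = {(i, t mod q) | i t. sum z {..<i} \<le> t \<and> t < sum z {..<Suc i}}"

lemma inj_on_mod_interval:
  fixes m w q :: nat
  assumes "w \<le> q"
  shows "inj_on (\<lambda>t. t mod q) {m..<m + w}"
proof (rule linorder_inj_onI')
  fix s t assume st: "s \<in> {m..<m + w}" "t \<in> {m..<m + w}" "s < t"
  show "s mod q \<noteq> t mod q"
  proof
    assume "s mod q = t mod q"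
    then have "q dvd t - s"
      using st(3) mod_eq_dvd_iff_nat[of s t q] by simp
    then have "q \<le> t - s"
      using st(3) by (intro dvd_imp_le) auto
    then show False
      using st assms by auto
  qed
qed

lemma cyclic_fill_row:
  "cyclic_fill z q `` {i} = (\<lambda>t. t mod q) ` {sum z {..<i}..<sum z {..<i} + z i}"
  by (auto simp: cyclic_fill_def)

lemma card_cyclic_fill_row: "z i \<le> q \<Longrightarrow> card (cyclic_fill z q `` {i}) = z i"
  by (simp add: cyclic_fill_row card_image inj_on_mod_interval)

lemma cyclic_fill_col_less: "q > 0 \<Longrightarrow> (i, j) \<in> cyclic_fill z q \<Longrightarrow> j < q"
  by (auto simp: cyclic_fill_def)

text \<open>The rows use consecutive intervals that tile the numbers below the total sum, and an
  interval of length at most \<open>q\<close> meets each residue class at most once.\<close>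

lemma card_cyclic_fill_col:
  assumes "\<And>i. i < p \<Longrightarrow> z i \<le> q"
  shows "card {i. i < p \<and> (i, j) \<in> cyclic_fill z q} = card {t. t < sum z {..<p} \<and> t mod q = j}"
  using assms
proof (induction p)
  case 0
  then show ?case
    by simp
next
  case (Suc p)
  let ?S = "sum z {..<p}"
  let ?T = "{t \<in> {?S..<?S + z p}. t mod q = j}"
  have inj: "inj_on (\<lambda>t. t mod q) {?S..<?S + z p}"
    using Suc.prems by (intro inj_on_mod_interval) auto
  have T: "card ?T = of_bool ((p, j) \<in> cyclic_fill z q)"
  proof (cases "(p, j) \<in> cyclic_fill z q")
    case True
    then obtain t where t: "t \<in> {?S..<?S + z p}" "t mod q = j"
      by (auto simp: cyclic_fill_def)
    then have "?T = {t}"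
      using inj by (auto dest: inj_onD)
    then show ?thesis
      using True by simp
  next
    case False
    then have "?T = {}"
      by (auto simp: cyclic_fill_def)
    then show ?thesis
      using False by (simp only:) simp
  qed
  let ?F = "cyclic_fill z q"
  have "{i. i < Suc p \<and> (i, j) \<in> ?F}
      = {i. i < p \<and> (i, j) \<in> ?F} \<union> (if (p, j) \<in> ?F then {p} else {})"
    by (auto simp: less_Suc_eq)
  then have "card {i. i < Suc p \<and> (i, j) \<in> ?F} = card {i. i < p \<and> (i, j) \<in> ?F} + card ?T"
    unfolding T by simp
  moreover have "card {t. t < m + w \<and> Q t} = card {t. t < m \<and> Q t} + card {t \<in> {m..<m + w}. Q t}"
    for m w :: nat and Q
  proof -
    have "{t. t < m + w \<and> Q t} = {t. t < m \<and> Q t} \<union> {t \<in> {m..<m + w}. Q t}"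
      by auto
    moreover have "card ({t. t < m \<and> Q t} \<union> {t \<in> {m..<m + w}. Q t})
        = card {t. t < m \<and> Q t} + card {t \<in> {m..<m + w}. Q t}"
      by (rule card_Un_disjoint) auto
    ultimately show ?thesis
      by (rule ssubst)
  qed
  from this[of ?S "z p" "\<lambda>t. t mod q = j"]
  have "card {t. t < sum z {..<Suc p} \<and> t mod q = j}
      = card {t. t < ?S \<and> t mod q = j} + card ?T"
    by simp
  ultimately show ?case
    using Suc by simp
qed

lemma card_mod_eq:
  fixes q c j :: nat
  assumes "j < q"
  shows "card {t. t < q * c \<and> t mod q = j} = c"
proof -
  have "{t. t < q * c \<and> t mod q = j} = (\<lambda>m. q * m + j) ` {..<c}"
  proof (intro equalityI subsetI)
    fix t assume "t \<in> {t. t < q * c \<and> t mod q = j}"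
    then have "t = q * (t div q) + j" "t div q < c"
      using less_mult_imp_div_less[of t c q] by (auto simp: mult.commute)
    then show "t \<in> (\<lambda>m. q * m + j) ` {..<c}"
      by blast
  next
    fix t assume "t \<in> (\<lambda>m. q * m + j) ` {..<c}"
    then obtain m where m: "m < c" "t = q * m + j"
      by auto
    have "q * m + j < q * Suc m"
      using assms by simp
    also have "\<dots> \<le> q * c"
      using m(1) by (intro mult_le_mono2) simp
    finally show "t \<in> {t. t < q * c \<and> t mod q = j}"
      using m assms by simp
  qed
  moreover have "inj_on (\<lambda>m. q * m + j) {..<c}"
    using assms by (auto simp: inj_on_def)
  ultimately show ?thesis
    by (simp add: card_image)
qed

lemma sum_card_mod_eq:
  fixes q N :: nat
  assumes "q > 0"
  shows "(\<Sum>j<q. card {t. t < N \<and> t mod q = j}) = N"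
proof -
  have "(\<Sum>j<q. card {t. t < N \<and> t mod q = j}) = card (\<Union>j<q. {t. t < N \<and> t mod q = j})"
    by (rule card_UN_disjoint[symmetric]) auto
  also have "(\<Union>j<q. {t. t < N \<and> t mod q = j}) = {..<N}"
    using assms by auto
  finally show ?thesis
    by simp
qed

section \<open>Construction of dominating sets\<close>

text \<open>
  Besides the full block, the first \<open>u\<close> columns receive \<open>k - u\<close> cells each by a cyclic filling;
  \<open>w x\<close> of these lie in row \<open>u + x\<close>. A second cyclic filling with the missing row sums
  fills the last \<open>s\<close> columns; it has \<open>s * (k + 1)\<close> cells, so it is exactly even.
\<close>

lemma ex_near_regular:
  assumes uk: "u \<le> k" and kn: "k \<le> u + s" and s: "s > 0"
    and count: "s * (k + 1) \<le> s * s + u * (k - u)"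
  obtains A where "A \<subseteq> {..<u + s} \<times> {..<u + s}" and "{..<u} \<times> {..<u} \<subseteq> A"
    and "\<And>x. x < u + s \<Longrightarrow> deg A x = (if x < u then k else k + 1)"
    and "\<And>y. y < u + s \<Longrightarrow> deg (A\<inverse>) y = (if y < u then k else k + 1)"
proof -
  define N where "N = u * (k - u)"
  define B where "B = cyclic_fill (\<lambda>_. k - u) s"
  define w where "w x = card {y. y < u \<and> (y, x) \<in> B}" for x
  define z where "z x = (if x < u then k - u else k + 1 - w (x - u))" for x
  define C where "C = cyclic_fill z s"
  have w_eq: "w x = card {t. t < N \<and> t mod s = x}" for x
    using kn card_cyclic_fill_col[of u "\<lambda>_. k - u" s x] by (simp add: w_def B_def N_def)
  have w_le: "w x \<le> u" for x
  proof -
    have "w x \<le> card {..<u}"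
      unfolding w_def by (intro card_mono) auto
    then show ?thesis
      by simp
  qed
  \<comment> \<open>Here \<open>count\<close> enters: the first filling is large enough to give each
    residue \<open>k + 1 - s\<close> cells, so no row of the second filling needs more than
    \<open>s\<close>. Truncation covers \<open>s > k + 1\<close>.\<close>
  have w_ge: "k + 1 - s \<le> w x" if "x < s" for x
  proof -
    have "s * (k + 1 - s) \<le> N"
      using count by (simp add: N_def diff_mult_distrib2)
    then have "card {t. t < s * (k + 1 - s) \<and> t mod s = x} \<le> w x"
      unfolding w_eq by (intro card_mono) auto
    then show ?thesis
      using card_mod_eq[OF that] by simp
  qed
  have z_le: "z x \<le> s" if "x < u + s" for x
  proof (cases "x < u")
    case False
    then have "x - u < s"
      using that by simp
    from w_ge[OF this] show ?thesis
      using False by (simp add: z_def)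
  qed (use kn in \<open>simp add: z_def\<close>)
  \<comment> \<open>The first \<open>u\<close> rows of the second filling need as many cells as the
    first filling has, namely \<open>u * (k - u)\<close>. Pairing these with the other rows gives
    \<open>k + 1\<close> for each of the \<open>s\<close> rows.\<close>
  have "sum z {..<u + s} = sum z {..<u} + (\<Sum>x<s. z (u + x))"
    by (induction s) (auto simp: add.assoc)
  also have "sum z {..<u} = (\<Sum>x<u. k - u)"
    by (intro sum.cong) (auto simp: z_def)
  also have "\<dots> = (\<Sum>x<s. w x)"
    by (simp add: w_eq sum_card_mod_eq[OF s] N_def)
  also have "(\<Sum>x<s. w x) + (\<Sum>x<s. z (u + x)) = (\<Sum>x<s. k + 1)"
    unfolding sum.distrib[symmetric]
  proof (intro sum.cong refl)
    fix x
    show "w x + z (u + x) = k + 1"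
      using w_le[of x] uk by (simp add: z_def)
  qed
  finally have z_sum: "sum z {..<u + s} = s * (k + 1)"
    by simp
  \<comment> \<open>\<open>B\<close> enters transposed, since its rows are the first
    \<open>u\<close> columns of \<open>A\<close>. \<open>C\<close> occupies the last
    \<open>s\<close> columns.\<close>
  define A where "A = {..<u} \<times> {..<u} \<union> {(u + x, y) | x y. y < u \<and> (y, x) \<in> B}
    \<union> {(x, u + y) | x y. x < u + s \<and> (x, y) \<in> C}"
  have B_less: "x < s" if "(y, x) \<in> B" for x y
    using that s cyclic_fill_col_less unfolding B_def by blast
  have C_less: "y < s" if "(x, y) \<in> C" for x y
    using that s cyclic_fill_col_less unfolding C_def by blast
  have fin: "finite (C `` {x})" "finite {y. y < u \<and> P y}" "finite {y. y < u + s \<and> P y}"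
    "finite (B `` {x})" for x P
    using C_less B_less by (auto intro: finite_subset[of _ "{..<s}"])
  have C_row: "card (C `` {x}) = z x" if "x < u + s" for x
    unfolding C_def using z_le[OF that] by (rule card_cyclic_fill_row)
  have B_row: "card (B `` {y}) = k - u" for y
    unfolding B_def using kn by (intro card_cyclic_fill_row) simp
  have C_col: "card {x. x < u + s \<and> (x, y) \<in> C} = k + 1" if "y < s" for y
    using card_cyclic_fill_col[of "u + s" z s y] z_le card_mod_eq[OF that, of "k + 1"]
    by (simp add: C_def z_sum)
  have row: "deg A x = (if x < u then k else k + 1)" if x: "x < u + s" for x
  proof (cases "x < u")
    case True
    have "A `` {x} = {..<u} \<union> (+) u ` (C `` {x})"
      using True by (auto simp: A_def)
    moreover have "card ({..<u} \<union> (+) u ` (C `` {x})) = u + z x"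
      using fin C_row[OF x] by (subst card_Un_disjoint) (auto simp: card_image)
    ultimately show ?thesis
      using True uk by (simp add: deg_def z_def)
  next
    case False
    have "A `` {x} = {y. y < u \<and> (y, x - u) \<in> B} \<union> (+) u ` (C `` {x})"
      using False x by (auto simp: A_def)
    moreover have "card ({y. y < u \<and> (y, x - u) \<in> B} \<union> (+) u ` (C `` {x})) = w (x - u) + z x"
      using fin C_row[OF x] by (subst card_Un_disjoint) (auto simp: card_image w_def)
    ultimately show ?thesis
      using False w_le[of "x - u"] uk by (simp add: deg_def z_def)
  qed
  have col: "deg (A\<inverse>) y = (if y < u then k else k + 1)" if y: "y < u + s" for y
  proof (cases "y < u")
    case True
    have "A\<inverse> `` {y} = {..<u} \<union> (+) u ` (B `` {y})"
      using True by (auto simp: A_def)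
    moreover have "card ({..<u} \<union> (+) u ` (B `` {y})) = u + (k - u)"
      using fin B_row by (subst card_Un_disjoint) (auto simp: card_image)
    ultimately show ?thesis
      using True uk by (simp add: deg_def)
  next
    case False
    have "A\<inverse> `` {y} = {x. x < u + s \<and> (x, y - u) \<in> C}"
      using False by (auto simp: A_def)
    then show ?thesis
      using False y C_col[of "y - u"] by (simp add: deg_def)
  qed
  show ?thesis
    by (rule that[of A]) (use row col B_less C_less in \<open>auto simp: A_def\<close>)
qed

text \<open>A cell outside \<open>A\<close> avoids the full block, so one of its two lines has
  degree \<open>k + 1\<close>. If \<open>u = 0\<close>, both have, which allows one more in
  \<open>a\<close>.\<close>

lemma ex_dominating:
  assumes "u \<le> k" "k \<le> u + s" "s > 0" "s * (k + 1) \<le> s * s + u * (k - u)"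
    and a: "a \<le> 2 * k + 1 \<or> u = 0 \<and> a \<le> 2 * k + 2"
  obtains A where "dominating a (u + s) A" and "card A = k * (u + s) + s"
proof -
  obtain A where A: "A \<subseteq> {..<u + s} \<times> {..<u + s}" "{..<u} \<times> {..<u} \<subseteq> A"
    "\<And>x. x < u + s \<Longrightarrow> deg A x = (if x < u then k else k + 1)"
    "\<And>y. y < u + s \<Longrightarrow> deg (A\<inverse>) y = (if y < u then k else k + 1)"
    using ex_near_regular[OF assms(1-4)] by metis
  have "dominating a (u + s) A"
    unfolding dominating_def
  proof (intro conjI allI impI)
    fix x y assume xy: "x < u + s" "y < u + s" "(x, y) \<notin> A"
    then have "\<not> (x < u \<and> y < u)"
      using A(2) by auto
    then show "a \<le> deg A x + deg (A\<inverse>) y"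
      using a A(3)[OF xy(1)] A(4)[OF xy(2)] by auto
  qed (rule A(1))
  moreover have "card A = k * (u + s) + s"
  proof -
    have "int (card A) = (\<Sum>x<u + s. int (if x < u then k else k + 1))"
      unfolding card_eq_sum_deg(1)[OF A(1), symmetric] using A(3) by (intro sum.cong) auto
    also have "\<dots> = int (k * (u + s) + s)"
      by (induction s) (auto simp: algebra_simps)
    finally show ?thesis
      by (simp only: of_nat_eq_iff)
  qed
  ultimately show ?thesis
    by (rule that)
qed

section \<open>Exact values by parity and size of the threshold\<close>

lemma gamma_num_triangle_even:
  assumes "k < n" "k > 0"
  shows "gamma_num (triangle (2 * k)) n n = k * n"
proof -
  \<comment> \<open>With \<open>u = 0\<close> all degrees are one above the parameter, hence
    \<open>k - 1\<close>.\<close>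
  obtain A where "dominating (2 * k) (0 + n) A" "card A = (k - 1) * (0 + n) + n"
    by (rule ex_dominating[of 0 "k - 1" n "2 * k"]) (use assms in auto)
  moreover have "(k - 1) * n + n = k * n"
    using assms by (cases k) auto
  ultimately show ?thesis
    using dominating_even_card_ge[OF _ assms(1)] by (intro gamma_num_triangle_eqI) auto
qed

lemma gamma_num_triangle_odd_small:
  assumes "2 * k + 1 \<le> n"
  shows "gamma_num (triangle (2 * k + 1)) n n = k * n + (n - k)"
proof -
  \<comment> \<open>For \<open>u = k\<close> the first filling is empty, and the counting condition
    reduces to \<open>k + 1 \<le> n - k\<close>.\<close>
  have "(n - k) * (k + 1) \<le> (n - k) * (n - k)"
    using assms by (intro mult_le_mono2) simp
  then obtain A where "dominating (2 * k + 1) (k + (n - k)) A" "card A = k * (k + (n - k)) + (n - k)"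
    using ex_dominating[of k k "n - k" "2 * k + 1"] assms by auto
  then show ?thesis
    using dominating_odd_small_card_ge[OF _ assms] assms by (intro gamma_num_triangle_eqI) auto
qed

lemma gamma_num_triangle_odd_large:
  assumes "k < n" "n \<le> 2 * k"
  shows "real (gamma_num (triangle (2 * k + 1)) n n) = real k * real n
    + of_int \<lceil>real n * (real n - real k) / (2 * real n - 2 * real k - 1)\<rceil>"
proof -
  let ?k = "int k" and ?n = "int n"
  let ?D = "2 * ?n - 2 * ?k - 1"
  define c where "c = \<lceil>real n * (real n - real k) / (2 * real n - 2 * real k - 1)\<rceil>"
  have D: "?D > 0"
    using assms by simp
  \<comment> \<open>The ceiling is the least integer satisfying the inequality of the lower
    bound.\<close>
  have c_le: "c \<le> m \<longleftrightarrow> ?n * (?n - ?k) \<le> ?D * m" for m :: int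
  proof -
    have pos: "2 * real n - 2 * real k - 1 > 0"
      using assms by simp
    have "c \<le> m \<longleftrightarrow> real n * (real n - real k) \<le> of_int m * (2 * real n - 2 * real k - 1)"
      unfolding c_def ceiling_le_iff by (rule pos_divide_le_eq[OF pos])
    also have "\<dots> \<longleftrightarrow> real_of_int (?n * (?n - ?k)) \<le> real_of_int (?D * m)"
      by (simp add: mult.commute)
    finally show ?thesis
      by (simp only: of_int_le_iff)
  qed
  have c_ge: "?n * (?n - ?k) \<le> ?D * c"
    using c_le[of c] by simp
  have "c \<le> ?n"
    unfolding c_le using assms by (subst mult.commute[of ?n], intro mult_right_mono) auto
  have "0 < ?D * c"
    using c_ge assms by (intro less_le_trans[OF _ c_ge] mult_pos_pos) auto
  then have "c > 0"
    using D zero_less_mult_pos by blast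
  define s where "s = nat c"
  define u where "u = n - s"
  have s: "int s = c" "s > 0" "s \<le> n"
    using \<open>c > 0\<close> \<open>c \<le> ?n\<close> by (auto simp: s_def)
  have u: "u + s = n" "int u = ?n - c"
    using s by (auto simp: u_def of_nat_diff)
  \<comment> \<open>Since \<open>2 * (n - k) = ?D + 1\<close>, the bound \<open>c_ge\<close> makes
    \<open>u\<close> at most half of \<open>n\<close>, and \<open>n \<le> 2 * k\<close> then gives
    \<open>u \<le> k\<close>.\<close>
  have "?D * (2 * int u) \<le> ?D * ?n"
  proof -
    have "?D * (2 * int u) \<le> ?D * ?n - ?n"
      using c_ge by (simp add: u(2) algebra_simps)
    then show ?thesis
      by simp
  qed
  then have "2 * int u \<le> ?n"
    using D by (subst (asm) mult_le_cancel_left) auto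
  then have uk: "u \<le> k"
    using assms by simp
  \<comment> \<open>After substituting \<open>u = n - s\<close>, the counting condition of the
    construction is the inequality \<open>c_ge\<close> itself, so both bounds meet.\<close>
  have "int s * (?k + 1) \<le> int s * int s + int u * (?k - int u)"
    using c_ge unfolding s(1) u(2) by (simp add: algebra_simps)
  then have "int (s * (k + 1)) \<le> int (s * s + u * (k - u))"
    using uk by (simp add: of_nat_diff distrib_left add.commute)
  then have "s * (k + 1) \<le> s * s + u * (k - u)"
    by (simp only: of_nat_le_iff)
  then obtain A where A: "dominating (2 * k + 1) (u + s) A" "card A = k * (u + s) + s"
    using ex_dominating[of u k s "2 * k + 1"] uk s(2) assms u(1) by auto
  have "k * n + s \<le> card B" if "dominating (2 * k + 1) n B" for B
  proof -
    have "c \<le> int (card B) - ?k * ?n"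
      unfolding c_le by (rule dominating_odd_card_ge[OF that])
    then have "int (k * n + s) \<le> int (card B)"
      using s(1) by simp
    then show ?thesis
      by (simp only: of_nat_le_iff)
  qed
  then have "gamma_num (triangle (2 * k + 1)) n n = k * n + s"
    using A u(1) by (intro gamma_num_triangle_eqI) auto
  moreover have "real s = of_int c"
    using s(1) by (metis of_int_of_nat_eq)
  ultimately show ?thesis
    by (simp add: c_def)
qed

theorem theorem1p3:
  fixes n a :: nat
  assumes "n \<ge> 2" and "1 \<le> a" and "a \<le> 2 * n - 2"
  shows "(even a \<longrightarrow>
            real (gamma_num (triangle a) n n) = real a * real n / 2)
       \<and> (odd a \<and> a \<le> n \<longrightarrow>
            real (gamma_num (triangle a) n n) = (real a + 1) / 2 * real n - (real a - 1) / 2)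
       \<and> (odd a \<and> a > n \<longrightarrow>
            real (gamma_num (triangle a) n n) =
              (real a - 1) / 2 * real n
              + of_int \<lceil>real n * (2 * real n - real a + 1) / (2 * (2 * real n - real a))\<rceil>)"
proof (cases "even a")
  case True
  then obtain k where k: "a = 2 * k"
    by (elim evenE)
  then have "k < n" "k > 0"
    using assms by auto
  then show ?thesis
    using gamma_num_triangle_even[of k n] by (simp add: k)
next
  case False
  then obtain k where k: "a = 2 * k + 1"
    by (elim oddE)
  show ?thesis
  proof (cases "a \<le> n")
    case True
    then show ?thesis
      using gamma_num_triangle_odd_small[of k n] by (simp add: k algebra_simps)
  next
    case False
    have "real n * (2 * real n - real a + 1) / (2 * (2 * real n - real a))
        = (2 * (real n * (real n - real k))) / (2 * (2 * real n - 2 * real k - 1))"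
      by (simp add: k algebra_simps)
    also have "\<dots> = real n * (real n - real k) / (2 * real n - 2 * real k - 1)"
      by (rule mult_divide_mult_cancel_left) simp
    finally show ?thesis
      using gamma_num_triangle_odd_large[of k n] False assms by (simp add: k)
  qed
qed

end
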